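(* For every integer $k\ge 1$, the sequence $(\mathcal{F}(n,k))_{n=k}^\infty$ (the $k$th left-down diagonal of the Fibonacci-Fubini triangle) satisfies the $k$th order homogeneous linear recurrence relation with constant coefficients $$0 = \sum_{j=0}^{k} {k+1 \brack k-j+1}\,\mathcal{F}(n-j,k), \qquad n\geq k+1,$$ where ${\cdot\brack\cdot}$ are the (signed) Stirling numbers of the first kind.
   Context: $F_m$ denotes the Fibonacci numbers: $F_0=0$, $F_1=1$, $F_m=F_{m-1}+F_{m-2}$ for $m\ge 2$. ${n\brace k}$ denotes the Stirling number of the second kind (the number of partitions of an $n$-element set into exactly $k$ non-empty blocks; ${n\brace k}=0$ for $k>n$). The Fibonacci-Fubini triangle has entries $\mathcal{F}(n,k)=F_{k+1}{n\brace k}$, so $\mathcal{F}(n,k)=0$ for $k>n$. The Stirling numbers of the first kind ${n\brack k}$ are signed: ${n\brack n}=1$, ${n\brack 0}=0$ for $n\ge1$, ${n\brack k}=0$ for $k>n$, and ${n \brack k} = {n-1 \brack k-1} - (n-1){n-1 \brack k}$ for $n,k\ge1$; equivalently $x(x-1)\cdots(x-n+1)=\sum_{k=0}^n{n\brack k}x^k$. *)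

theory Defs
  imports "HOL-Combinatorics.Stirling" "HOL-Number_Theory.Fib"
begin

text \<open>
  The library function \<open>stirling\<close> gives the unsigned Stirling numbers of the first kind;
  the two lemmas after the definition relate the signed ones to it and to the falling factorial.
\<close>

fun signed_stirling :: "nat \<Rightarrow> nat \<Rightarrow> int"
  where
    "signed_stirling 0 0 = 1"
  | "signed_stirling 0 (Suc k) = 0"
  | "signed_stirling (Suc n) 0 = 0"
  | "signed_stirling (Suc n) (Suc k) = signed_stirling n k - int n * signed_stirling n (Suc k)"

lemma signed_stirling_eq_stirling:
  "signed_stirling n k = (- 1) ^ (n + k) * int (stirling n k)"
  by (induct n k rule: signed_stirling.induct) (simp_all add: algebra_simps)

lemma signed_stirling_falling_factorial:
  "(\<Sum>k\<le>n. of_int (signed_stirling n k) * x ^ k) = (\<Prod>i<n. x - of_nat i :: 'a::comm_ring_1)"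
proof (induct n)
  case 0
  then show ?case by simp
next
  case (Suc n)
  have top: "signed_stirling n (Suc n) = 0"
    by (simp add: signed_stirling_eq_stirling)
  have shift: "(\<Sum>k\<le>n. of_nat n * (of_int (signed_stirling n (Suc k)) * x ^ Suc k))
      = of_nat n * (\<Sum>k\<le>n. of_int (signed_stirling n k) * x ^ k)"
  proof -
    have bottom: "of_nat n * of_int (signed_stirling n 0) = (0 :: 'a)"
      by (cases n) simp_all
    have "(\<Sum>k\<le>n. of_int (signed_stirling n k) * x ^ k)
        = (\<Sum>k\<le>Suc n. of_int (signed_stirling n k) * x ^ k)"
      by (simp add: top)
    also have "\<dots> = of_int (signed_stirling n 0)
        + (\<Sum>k\<le>n. of_int (signed_stirling n (Suc k)) * x ^ Suc k)"
      by (subst sum.atMost_Suc_shift) simp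
    finally show ?thesis
      by (simp only: distrib_left bottom add_0_left sum_distrib_left)
  qed
  have "(\<Sum>k\<le>Suc n. of_int (signed_stirling (Suc n) k) * x ^ k)
      = (\<Sum>k\<le>n. of_int (signed_stirling (Suc n) (Suc k)) * x ^ Suc k)"
    by (subst sum.atMost_Suc_shift) simp
  also have "\<dots> = (\<Sum>k\<le>n. x * (of_int (signed_stirling n k) * x ^ k))
      - (\<Sum>k\<le>n. of_nat n * (of_int (signed_stirling n (Suc k)) * x ^ Suc k))"
    by (simp add: sum_subtractf [symmetric] algebra_simps)
  also have "\<dots> = (x - of_nat n) * (\<Sum>k\<le>n. of_int (signed_stirling n k) * x ^ k)"
    unfolding shift by (simp add: sum_distrib_left [symmetric] left_diff_distrib)
  also have "\<dots> = (\<Prod>i<Suc n. x - of_nat i)"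
    by (simp add: Suc)
  finally show ?case .
qed

definition fibonacci_fubini :: "nat \<Rightarrow> nat \<Rightarrow> nat"
  where "fibonacci_fubini n k = fib (k + 1) * Stirling n k"

end

theory Submission
  imports Defs
begin

text \<open>
  Let \<open>E\<close> be the shift operator on sequences. The Stirling recurrence says that \<open>E - k\<close> maps
  the \<open>k\<close>-th column of the Stirling triangle of the second kind to the \<open>(k - 1)\<close>-st one, so the
  falling factorial \<open>E (E - 1) \<dots> (E - k)\<close>, whose coefficients are the signed Stirling numbers of
  the first kind, annihilates the \<open>k\<close>-th column. The factor \<open>F\<^bsub>k+1\<^esub>\<close> is constant along the column.
\<close>

text \<open>Splits the factor \<open>E - r\<close> off the falling factorial
  \<open>E (E - 1) ... (E - r)\<close> and applies it to \<open>f\<close> first.\<close>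

lemma signed_stirling_sum_Suc:
  fixes f :: "nat \<Rightarrow> int"
  shows "(\<Sum>i\<le>Suc r. signed_stirling (Suc r) i * f i)
    = (\<Sum>i\<le>r. signed_stirling r i * (f (Suc i) - int r * f i))"
proof -
  have top: "signed_stirling r (Suc r) = 0"
    by (simp add: signed_stirling_eq_stirling)
  have bottom: "int r * signed_stirling r 0 = 0"
    by (cases r) simp_all
  have "(\<Sum>i\<le>r. signed_stirling r i * f i) = (\<Sum>i\<le>Suc r. signed_stirling r i * f i)"
    by (simp add: top)
  also have "\<dots> = signed_stirling r 0 * f 0 + (\<Sum>i\<le>r. signed_stirling r (Suc i) * f (Suc i))"
    by (rule sum.atMost_Suc_shift)
  finally have shift: "int r * (\<Sum>i\<le>r. signed_stirling r i * f i)
      = int r * (\<Sum>i\<le>r. signed_stirling r (Suc i) * f (Suc i))"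
    using bottom by (auto simp: distrib_left)
  have "(\<Sum>i\<le>Suc r. signed_stirling (Suc r) i * f i)
      = (\<Sum>i\<le>r. signed_stirling (Suc r) (Suc i) * f (Suc i))"
    by (subst sum.atMost_Suc_shift) simp
  also have "\<dots> = (\<Sum>i\<le>r. signed_stirling r i * f (Suc i))
      - int r * (\<Sum>i\<le>r. signed_stirling r (Suc i) * f (Suc i))"
    by (simp add: sum_subtractf sum_distrib_left algebra_simps)
  also have "\<dots> = (\<Sum>i\<le>r. signed_stirling r i * (f (Suc i) - int r * f i))"
    unfolding shift [symmetric] by (simp add: sum_subtractf sum_distrib_left algebra_simps)
  finally show ?thesis .
qed

text \<open>By induction, splitting off \<open>E - Suc k\<close> lowers the column by one. For
  column 0 only \<open>E\<close> is left, and \<open>Stirling (m + 1) 0 = 0\<close> even when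
  \<open>m = 0\<close>.\<close>

lemma signed_stirling_annihilates_Stirling:
  "(\<Sum>i\<le>Suc k. signed_stirling (Suc k) i * int (Stirling (m + i) k)) = 0"
proof (induct k)
  case 0
  then show ?case by simp
next
  case (Suc k)
  have "int (Stirling (m + Suc i) (Suc k)) - int (Suc k) * int (Stirling (m + i) (Suc k))
      = int (Stirling (m + i) k)" for i
    by (simp add: algebra_simps)
  with Suc show ?case
    by (simp only: signed_stirling_sum_Suc [of "Suc k"])
qed

theorem theorem10:
  fixes k :: nat
  assumes "k \<ge> 1"
  shows "signed_stirling (k + 1) (k + 1) \<noteq> 0 \<and> signed_stirling (k + 1) 1 \<noteq> 0 \<and>
    (\<forall>n\<ge>k + 1. 0 = (\<Sum>j = 0..k. signed_stirling (k + 1) (k - j + 1) * int (fibonacci_fubini (n - j) k)))"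
proof (intro conjI allI impI)
  \<comment> \<open>The extreme coefficients are \<open>1\<close> and \<open>(-1)^k * k!\<close>, so
    the order is exactly \<open>k\<close>.\<close>
  show "signed_stirling (k + 1) (k + 1) \<noteq> 0"
    by (simp only: signed_stirling_eq_stirling) simp
  show "signed_stirling (k + 1) 1 \<noteq> 0"
    using stirling_Suc_n_1 [of k] by (simp add: signed_stirling_eq_stirling del: signed_stirling.simps stirling.simps)
  fix n assume "n \<ge> k + 1"
  then obtain m where n: "n = k + 1 + m"
    using le_Suc_ex by blast
  have "(\<Sum>j = 0..k. signed_stirling (k + 1) (k - j + 1) * int (fibonacci_fubini (n - j) k))
      = (\<Sum>i\<le>k. signed_stirling (k + 1) (Suc i) * int (fibonacci_fubini (m + Suc i) k))"
    \<comment> \<open>Reversal \<open>i = k - j\<close>, under which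
      \<open>n - j = m + Suc i\<close>.\<close>
    by (rule sum.reindex_bij_witness [of _ "\<lambda>i. k - i" "\<lambda>j. k - j"]) (auto simp: n Suc_diff_le algebra_simps)
  also have "\<dots> = int (fib (k + 1))
      * (\<Sum>i\<le>k. signed_stirling (Suc k) (Suc i) * int (Stirling (m + Suc i) k))"
    by (simp add: fibonacci_fubini_def sum_distrib_left algebra_simps
        del: signed_stirling.simps Stirling.simps)
  \<comment> \<open>The new term \<open>i = 0\<close> has coefficient 0; its row
    \<open>m = n - k - 1\<close> exists because \<open>n \<ge> k + 1\<close>.\<close>
  also have "(\<Sum>i\<le>k. signed_stirling (Suc k) (Suc i) * int (Stirling (m + Suc i) k))
      = (\<Sum>i\<le>Suc k. signed_stirling (Suc k) i * int (Stirling (m + i) k))"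
    by (subst sum.atMost_Suc_shift) simp
  finally show "0 = (\<Sum>j = 0..k. signed_stirling (k + 1) (k - j + 1) * int (fibonacci_fubini (n - j) k))"
    by (simp only: signed_stirling_annihilates_Stirling)
qed

end
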